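(* Let $ABCD$ be a parallelogram in the Euclidean plane, with vertices $A,B,C,D$ listed in clockwise order. Let $M_1,M_2,M_3,M_4$ be the midpoints of the sides $BC$, $CD$, $DA$, $AB$ respectively, and join each vertex to the midpoint of an opposite side in clockwise order, i.e. draw the segments $AM_1$, $BM_2$, $CM_3$, $DM_4$. Let $EFGH$ be the inner quadrilateral formed by these segments, i.e. $E=AM_1\cap BM_2$, $F=BM_2\cap CM_3$, $G=CM_3\cap DM_4$, $H=DM_4\cap AM_1$. Then $$\text{area}(EFGH)=\tfrac15\,\text{area}(ABCD).$$
   Context: Parallelograms are nondegenerate (no three vertices collinear). $XY$ denotes the line segment with endpoints $X$ and $Y$. *)

theory Defs
  imports "HOL-Analysis.Analysis"
begin

text \<open>For nonzero difference vectors, linear dependence of \<open>B - A\<close> and \<open>C - D\<close> says that the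
  lines \<open>AB\<close> and \<open>CD\<close> have the same direction; they are distinct lines because no three of the
  points are collinear.\<close>

definition parallelogram :: "real^2 \<Rightarrow> real^2 \<Rightarrow> real^2 \<Rightarrow> real^2 \<Rightarrow> bool" where
  "parallelogram A B C D \<longleftrightarrow>
     \<not> collinear {A, B, C} \<and> \<not> collinear {B, C, D} \<and>
     \<not> collinear {C, D, A} \<and> \<not> collinear {D, A, B} \<and>
     collinear {0, B - A, C - D} \<and> collinear {0, C - B, D - A}"

definition right_turn :: "real^2 \<Rightarrow> real^2 \<Rightarrow> real^2 \<Rightarrow> bool" where
  "right_turn P Q R \<longleftrightarrow> (Q - P)$1 * (R - Q)$2 - (Q - P)$2 * (R - Q)$1 < 0"

text \<open>A convex polygon is traversed clockwise (first axis to the right, second axis up) iff one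
  turns right at each vertex.\<close>

definition clockwise :: "real^2 \<Rightarrow> real^2 \<Rightarrow> real^2 \<Rightarrow> real^2 \<Rightarrow> bool" where
  "clockwise A B C D \<longleftrightarrow>
     right_turn A B C \<and> right_turn B C D \<and> right_turn C D A \<and> right_turn D A B"

definition quad_boundary :: "real^2 \<Rightarrow> real^2 \<Rightarrow> real^2 \<Rightarrow> real^2 \<Rightarrow> (real^2) set" where
  "quad_boundary P Q R S =
     closed_segment P Q \<union> closed_segment Q R \<union> closed_segment R S \<union> closed_segment S P"

definition quad_area :: "real^2 \<Rightarrow> real^2 \<Rightarrow> real^2 \<Rightarrow> real^2 \<Rightarrow> real" where
  "quad_area P Q R S =
     measure lebesgue (quad_boundary P Q R S \<union> inside (quad_boundary P Q R S))"

end

theory Submission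
  imports Defs
begin

text \<open>With \<open>u = B - A\<close> and \<open>v = C - B\<close>, the segments \<open>A M1\<close> and \<open>B M2\<close> meet in
  \<open>E = A + 4/5 u + 2/5 v\<close>; the other three intersections follow by the affine quarter turn
  \<open>(A, u, v) \<mapsto> (B, v, -u)\<close>. Hence \<open>EFGH\<close> is a parallelogram with edge vectors
  \<open>(2v - u)/5\<close> and \<open>-(2u + v)/5\<close>, whose cross product is one fifth of that of
  \<open>u\<close> and \<open>v\<close>. The area of a parallelogram is the absolute cross product of its edges
  because it is the affine image of the unit square.\<close>

definition cross2 :: "real^2 \<Rightarrow> real^2 \<Rightarrow> real" where
  "cross2 u v = u$1 * v$2 - u$2 * v$1"

text \<open>A quarter turn of \<open>(u, v)\<close> in either direction has determinant 1. This
  carries the nondegeneracy hypothesis over to the turned instances of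
  \<open>segment_intersection\<close>.\<close>

lemma cross2_rotate: "cross2 v (- u) = cross2 u v" "cross2 (- v) u = cross2 u v"
  by (simp_all add: cross2_def algebra_simps)

text \<open>Cramer's rule: eliminating one unknown from the two coordinate equations leaves the
  other coefficient difference times \<open>cross2 u v\<close>.\<close>

lemma cross2_independent:
  assumes "cross2 u v \<noteq> 0" and "a *\<^sub>R u + b *\<^sub>R v = c *\<^sub>R u + d *\<^sub>R v"
  shows "a = c" and "b = d"
proof -
  have *: "(a - c) * u$i + (b - d) * v$i = 0" for i
    using arg_cong[OF assms(2), of "\<lambda>x. x$i"] by (simp add: algebra_simps)
  have "(a - c) * cross2 u v = 0" "(b - d) * cross2 u v = 0"
    using *[of 1] *[of 2] unfolding cross2_def by algebra+
  then show "a = c" "b = d"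
    using assms(1) by auto
qed

lemma linear_lincomb: "linear (\<lambda>x::real^2. x$1 *\<^sub>R u + x$2 *\<^sub>R v)"
  by (rule linearI) (simp_all add: algebra_simps)

lemma det_matrix_lincomb:
  "det (matrix (\<lambda>x::real^2. x$1 *\<^sub>R u + x$2 *\<^sub>R (v::real^2))) = cross2 u v"
  by (simp add: det_2 matrix_def axis_def cross2_def algebra_simps)

text \<open>Affine maps preserve segments; this carries the sides of the unit square to the sides of
  a parallelogram.\<close>

lemma lincomb_segment:
  fixes u v :: "real^2"
  shows "(\<lambda>x::real^2. P + (x$1 *\<^sub>R u + x$2 *\<^sub>R v)) ` closed_segment a b =
    closed_segment (P + (a$1 *\<^sub>R u + a$2 *\<^sub>R v)) (P + (b$1 *\<^sub>R u + b$2 *\<^sub>R v))"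
proof -
  have "closed_segment (P + (a$1 *\<^sub>R u + a$2 *\<^sub>R v)) (P + (b$1 *\<^sub>R u + b$2 *\<^sub>R v))
    = (+) P ` (\<lambda>x. x$1 *\<^sub>R u + x$2 *\<^sub>R v) ` closed_segment a b"
    by (simp add: closed_segment_translation closed_segment_linear_image[OF linear_lincomb])
  then show ?thesis
    by (simp add: image_image)
qed

lemma vec2_eq_iff: "x = y \<longleftrightarrow> x$1 = y$1 \<and> x$2 = (y::real^2)$2"
  by (simp add: vec_eq_iff forall_2)

lemma frontier_unit_square:
  "frontier (cbox 0 1 :: (real^2) set) =
     quad_boundary (vector [0,0]) (vector [1,0]) (vector [1,1]) (vector [0,1])"
proof -
  have seg: "x \<in> closed_segment a b \<longleftrightarrow>
      (\<exists>t. 0 \<le> t \<and> t \<le> 1 \<and> x$1 = (1-t) * a$1 + t * b$1 \<and> x$2 = (1-t) * a$2 + t * b$2)"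
    for x a b :: "real^2"
    by (auto simp: in_segment vec2_eq_iff)
  have bottom: "x \<in> closed_segment (vector [0,0]) (vector [1,0]) \<longleftrightarrow> 0 \<le> x$1 \<and> x$1 \<le> 1 \<and> x$2 = 0"
    and right: "x \<in> closed_segment (vector [1,0]) (vector [1,1]) \<longleftrightarrow> 0 \<le> x$2 \<and> x$2 \<le> 1 \<and> x$1 = 1"
    and top: "x \<in> closed_segment (vector [1,1]) (vector [0,1]) \<longleftrightarrow> 0 \<le> x$1 \<and> x$1 \<le> 1 \<and> x$2 = 1"
    and left: "x \<in> closed_segment (vector [0,1]) (vector [0,0]) \<longleftrightarrow> 0 \<le> x$2 \<and> x$2 \<le> 1 \<and> x$1 = 0"
    for x :: "real^2"
  proof -
    show "x \<in> closed_segment (vector [0,0]) (vector [1,0]) \<longleftrightarrow> 0 \<le> x$1 \<and> x$1 \<le> 1 \<and> x$2 = 0"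
      "x \<in> closed_segment (vector [1,0]) (vector [1,1]) \<longleftrightarrow> 0 \<le> x$2 \<and> x$2 \<le> 1 \<and> x$1 = 1"
      by (auto simp: seg)
    \<comment> \<open>The top and left sides are traversed from 1 down to 0, so the segment
      parameter is 1 minus the varying coordinate.\<close>
    show "x \<in> closed_segment (vector [1,1]) (vector [0,1]) \<longleftrightarrow> 0 \<le> x$1 \<and> x$1 \<le> 1 \<and> x$2 = 1"
      by (auto simp: seg intro: exI[of _ "1 - x$1"])
    show "x \<in> closed_segment (vector [0,1]) (vector [0,0]) \<longleftrightarrow> 0 \<le> x$2 \<and> x$2 \<le> 1 \<and> x$1 = 0"
      by (auto simp: seg intro: exI[of _ "1 - x$2"])
  qed
  show ?thesis
    by (auto simp: quad_boundary_def frontier_cbox mem_box_cart forall_2 bottom right top left)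
qed

lemma quad_area_parallelogram:
  assumes "cross2 u v \<noteq> 0"
  shows "quad_area P (P + u) (P + u + v) (P + v) = \<bar>cross2 u v\<bar>"
proof -
  let ?f = "\<lambda>x::real^2. x$1 *\<^sub>R u + x$2 *\<^sub>R v"
  let ?K = "cbox 0 1 :: (real^2) set"
  let ?S = "(+) P ` ?f ` ?K"
  \<comment> \<open>Injectivity lets the image commute with interiors and set differences, hence
    with the frontier of the square.\<close>
  have inj: "inj ?f"
    by (rule injI, subst vec2_eq_iff) (intro conjI cross2_independent[OF assms])
  have "compact ?S"
    by (intro compact_translation compact_continuous_image continuous_intros compact_cbox)
  then have "bounded ?S" and "closed ?S"
    by (simp_all add: compact_imp_bounded compact_imp_closed)
  have "convex ?S"
    by (intro convex_translation convex_linear_image linear_lincomb convex_box)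
  have "interior ?S = (+) P ` ?f ` interior ?K"
    unfolding interior_translation interior_injective_linear_image[OF linear_lincomb inj] ..
  then have "frontier ?S = ?S - (+) P ` ?f ` interior ?K"
    using \<open>closed ?S\<close> by (simp only: frontier_def closure_closed)
  also have "\<dots> = (+) P ` ?f ` frontier ?K"
    by (simp only: frontier_def closure_cbox image_set_diff[OF inj] image_set_diff[OF inj_on_add])
  also have "\<dots> = quad_boundary P (P + u) (P + u + v) (P + v)"
    by (simp add: frontier_unit_square quad_boundary_def image_Un image_image lincomb_segment
        add.assoc)
  finally have frontier: "frontier ?S = quad_boundary P (P + u) (P + u + v) (P + v)" .
  \<comment> \<open>For a bounded convex set the inside of the frontier is the interior, so the
    region measured by \<open>quad_area\<close> is exactly \<open>?S\<close>.\<close>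
  have "inside (frontier ?S) = interior ?S"
    using inside_frontier_eq_interior \<open>bounded ?S\<close> \<open>convex ?S\<close> by blast
  then have "frontier ?S \<union> inside (frontier ?S) = ?S"
    using interior_subset[of ?S] closure_closed[OF \<open>closed ?S\<close>]
    unfolding frontier_def by blast
  then have "quad_area P (P + u) (P + u + v) (P + v) = measure lebesgue ?S"
    by (simp only: quad_area_def frontier)
  also have "\<dots> = measure lebesgue (?f ` ?K)"
    by (rule measure_translation)
  \<comment> \<open>A linear map scales area by the absolute value of its determinant.\<close>
  also have "\<dots> = \<bar>cross2 u v\<bar> * measure lebesgue ?K"
    by (simp add: measure_linear_image[OF linear_lincomb] det_matrix_lincomb)
  also have "measure lebesgue ?K = 1"
    by (simp add: content_cbox_cart interval_ne_empty_cart)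
  finally show ?thesis by simp
qed

text \<open>Comparing coefficients of \<open>u\<close> and \<open>v\<close> at parameters
  \<open>s\<close> and \<open>t\<close> gives \<open>s = 1 - t/2\<close> and \<open>s/2 = t\<close>,
  whose only solution is \<open>s = 4/5\<close>, \<open>t = 2/5\<close>. Stated for arbitrary
  \<open>A\<close>, \<open>u\<close>, \<open>v\<close> so that it applies at all four
  vertices.\<close>

lemma segment_intersection:
  assumes "cross2 u v \<noteq> 0"
  shows "closed_segment A (A + u + (1/2) *\<^sub>R v) \<inter> closed_segment (A + u) (A + u + v - (1/2) *\<^sub>R u)
    = {A + (4/5) *\<^sub>R u + (2/5) *\<^sub>R v}" (is "?L \<inter> ?R = {?E}")
proof
  have "?E = (1 - 4/5) *\<^sub>R A + (4/5) *\<^sub>R (A + u + (1/2) *\<^sub>R v)"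
    "?E = (1 - 2/5) *\<^sub>R (A + u) + (2/5) *\<^sub>R (A + u + v - (1/2) *\<^sub>R u)"
    by (simp_all add: vec_eq_iff algebra_simps)
  then have "?E \<in> ?L" "?E \<in> ?R"
    unfolding in_segment by (auto intro: exI[of _ "4/5"] exI[of _ "2/5"] simp del: scaleR_add_right)
  then show "{?E} \<subseteq> ?L \<inter> ?R"
    by simp
  show "?L \<inter> ?R \<subseteq> {?E}"
  proof
    fix x assume "x \<in> ?L \<inter> ?R"
    then obtain s t where s: "x = (1 - s) *\<^sub>R A + s *\<^sub>R (A + u + (1/2) *\<^sub>R v)"
      and t: "x = (1 - t) *\<^sub>R (A + u) + t *\<^sub>R (A + u + v - (1/2) *\<^sub>R u)"
      by (metis IntE in_segment(1))
    have x: "x = A + (s *\<^sub>R u + (s/2) *\<^sub>R v)"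
      using s by (simp add: algebra_simps)
    have "x = A + ((1 - t/2) *\<^sub>R u + t *\<^sub>R v)"
      using t by (simp add: vec_eq_iff algebra_simps)
    then have "s *\<^sub>R u + (s/2) *\<^sub>R v = (1 - t/2) *\<^sub>R u + t *\<^sub>R v"
      using x by simp
    from cross2_independent[OF assms this] have s: "s = 4/5"
      by simp
    show "x \<in> {?E}"
      unfolding x s by (simp add: add.assoc)
  qed
qed

lemma right_turn_cross2: "right_turn P Q R \<longleftrightarrow> cross2 (Q - P) (R - Q) < 0"
  by (simp add: right_turn_def cross2_def)

lemma parallelogram_fourth_vertex:
  assumes "parallelogram A B C D" and "clockwise A B C D"
  shows "D = A + (C - B)"
proof -
  have ne: "B - A \<noteq> 0" "C - B \<noteq> 0" "C - D \<noteq> 0" "D - A \<noteq> 0"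
    and cross: "cross2 (B - A) (C - B) \<noteq> 0"
    using assms(2) by (auto simp: clockwise_def right_turn_cross2 cross2_def)
  obtain c d where c: "C - D = c *\<^sub>R (B - A)" and d: "D - A = d *\<^sub>R (C - B)"
    using assms(1) ne by (auto simp: parallelogram_def collinear_lemma)
  \<comment> \<open>Both sides equal \<open>C - A\<close>, reached through \<open>D\<close> on the
    left and through \<open>B\<close> on the right; independence then forces
    \<open>d = 1\<close>.\<close>
  have "c *\<^sub>R (B - A) + d *\<^sub>R (C - B) = 1 *\<^sub>R (B - A) + 1 *\<^sub>R (C - B)"
    by (simp flip: c d)
  with cross2_independent[OF cross this] d show ?thesis
    by (simp add: algebra_simps)
qed

theorem theorem1:
  fixes A B C D M1 M2 M3 M4 :: "real^2"
  assumes "parallelogram A B C D"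
    and "clockwise A B C D"
    and "M1 = midpoint B C"
    and "M2 = midpoint C D"
    and "M3 = midpoint D A"
    and "M4 = midpoint A B"
  shows "\<exists>E F G H.
           closed_segment A M1 \<inter> closed_segment B M2 = {E} \<and>
           closed_segment B M2 \<inter> closed_segment C M3 = {F} \<and>
           closed_segment C M3 \<inter> closed_segment D M4 = {G} \<and>
           closed_segment D M4 \<inter> closed_segment A M1 = {H} \<and>
           quad_area E F G H = 1 / 5 * quad_area A B C D"
proof -
  define u v where "u = B - A" and "v = C - B"
  have cross: "cross2 u v \<noteq> 0"
    using assms(2) by (auto simp: clockwise_def right_turn_cross2 u_def v_def)
  have B: "B = A + u" and C: "C = A + u + v" and D: "D = A + v"
    using parallelogram_fourth_vertex[OF assms(1,2)] by (simp_all add: u_def v_def)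
  let ?E = "A + (4/5) *\<^sub>R u + (2/5) *\<^sub>R v" and ?F = "B + (4/5) *\<^sub>R v - (2/5) *\<^sub>R u"
    and ?G = "C - (4/5) *\<^sub>R u - (2/5) *\<^sub>R v" and ?H = "D - (4/5) *\<^sub>R v + (2/5) *\<^sub>R u"
  \<comment> \<open>Each midpoint occurs in two intersections. The first form matches the first
    segment of \<open>segment_intersection\<close> at the vertex joined to it, the second form
    matches the second segment at the preceding vertex.\<close>
  have M1: "M1 = A + u + (1/2) *\<^sub>R v" "M1 = D + - v + u - (1/2) *\<^sub>R (- v)"
    and M2: "M2 = B + v + (1/2) *\<^sub>R (- u)" "M2 = A + u + v - (1/2) *\<^sub>R u"
    and M3: "M3 = C + - u + (1/2) *\<^sub>R (- v)" "M3 = B + v + - u - (1/2) *\<^sub>R v"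
    and M4: "M4 = D + - v + (1/2) *\<^sub>R u" "M4 = C + - u + - v - (1/2) *\<^sub>R (- u)"
    unfolding assms(3-6) B C D by (simp_all add: midpoint_def vec_eq_iff field_simps)
  have "closed_segment A M1 \<inter> closed_segment B M2 = {?E}"
    using segment_intersection[of u v A] cross by (simp add: B flip: M1 M2)
  moreover have "closed_segment B M2 \<inter> closed_segment C M3 = {?F}"
    using segment_intersection[of v "- u" B] cross unfolding cross2_rotate M2(1) M3(2)
    by (simp add: B C)
  moreover have "closed_segment C M3 \<inter> closed_segment D M4 = {?G}"
    using segment_intersection[of "- u" "- v" C] cross unfolding M3(1) M4(2)
    by (simp add: C D cross2_def)
  moreover have "closed_segment D M4 \<inter> closed_segment A M1 = {?H}"
    using segment_intersection[of "- v" u D] cross unfolding cross2_rotate M4(1) M1(2)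
    by (simp add: D)
  moreover have "quad_area ?E ?F ?G ?H = 1 / 5 * quad_area A B C D"
  proof -
    define p q where "p = (2/5) *\<^sub>R v - (1/5) *\<^sub>R u" and "q = - (2/5) *\<^sub>R u - (1/5) *\<^sub>R v"
    have FGH: "?F = ?E + p" "?G = ?E + p + q" "?H = ?E + q"
      unfolding p_def q_def B C D by (simp_all add: vec_eq_iff field_simps)
    \<comment> \<open>The coefficient determinant of \<open>p\<close>, \<open>q\<close> in terms of
      \<open>u\<close>, \<open>v\<close> is 1/25 + 4/25 = 1/5.\<close>
    have pq: "cross2 p q = cross2 u v / 5"
      unfolding p_def q_def cross2_def by (simp add: field_simps)
    have "quad_area ?E ?F ?G ?H = \<bar>cross2 u v / 5\<bar>"
      unfolding FGH pq[symmetric] using cross pq by (intro quad_area_parallelogram) simp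
    also have "\<dots> = 1 / 5 * quad_area A B C D"
      using quad_area_parallelogram[OF cross, of A] by (simp add: B C D)
    finally show ?thesis .
  qed
  ultimately show ?thesis by blast
qed

end
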